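(* Let $(\mathscr{P}_1,\mathscr{V}_1)$ be a locally convex cone and let $(\mathscr{P}_2,\mathscr{V}_2)$ be a separated full locally convex cone that is complete with respect to the symmetric topology. Let $v\in\mathscr{V}_2$ be a bounded element, and let $f,g,h:\mathscr{P}_1\to\mathscr{P}_2$ be mappings such that $$f(x+y)\in v\big(g(x)+h(y)\big)v\qquad\text{for all }x,y\in\mathscr{P}_1,$$ and such that $f(0)$ is bounded. Then there exists a unique additive mapping $A:\mathscr{P}_1\to\mathscr{P}_2$ for which there is a real number $\delta>0$ such that, for all $x\in\mathscr{P}_1$, $$A(x)\in(\delta v)\big(f(x)\big)(\delta v),$$ $$A(x)\in\big((1+\delta)v\big)\big(g(x)+h(0)\big)\big((1+\delta)v\big),$$ $$A(x)\in\big((1+\delta)v\big)\big(h(x)+g(0)\big)\big((1+\delta)v\big).$$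
   Context: A cone is a set $\mathscr{P}$ with an associative, commutative addition having a neutral element $0$, and a multiplication by real scalars $\lambda\ge 0$ satisfying $\lambda(\mu a)=(\lambda\mu)a$, $(\lambda+\mu)a=\lambda a+\mu a$, $\lambda(a+b)=\lambda a+\lambda b$, $1a=a$, $0a=0$. No cancellation law is assumed. A preordered cone is a cone with a reflexive transitive relation $\leqslant$ (not necessarily antisymmetric) such that $a\leqslant b$ implies $a+c\leqslant b+c$ and $\lambda a\leqslant\lambda b$ for all $c\in\mathscr{P}$, $\lambda\ge0$. An abstract $0$-neighborhood system in a preordered cone $\mathscr{P}$ is a subset $\mathscr{V}\subseteq\mathscr{P}$ such that: (i) $0<v$ (i.e. $0\leqslant v$ and $v\neq0$) for all $v\in\mathscr{V}$; (ii) for all $u,v\in\mathscr{V}$ there is $w\in\mathscr{V}$ with $w\leqslant u$ and $w\leqslant v$; (iii) $u+v\in\mathscr{V}$ and $\lambda v\in\mathscr{V}$ for all $u,v\in\mathscr{V}$, $\lambda>0$. A full locally convex cone is a pair $(\mathscr{P},\mathscr{V})$ of a preordered cone and an abstract $0$-neighborhood system $\mathscr{V}\subseteq\mathscr{P}$ such that every element is bounded below: for all $a\in\mathscr{P}$, $v\in\mathscr{V}$ there is $\rho>0$ with $0\leqslant a+\rho v$. A locally convex cone $(\mathscr{P},\mathscr{V})$ is a subcone $\mathscr{P}$ of a full locally convex cone with neighborhood system $\mathscr{V}$ ($\mathscr{P}$ need not contain $\mathscr{V}$; inequalities involving elements of $\mathscr{V}$ are taken in the full cone). For $v\in\mathscr{V}$,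 $a\in\mathscr{P}$: $v(a)=\{b\in\mathscr{P}: b\leqslant a+v\}$, $(a)v=\{b\in\mathscr{P}: a\leqslant b+v\}$, and $v(a)v=v(a)\cap(a)v$ is the symmetric neighborhood of $a$; these generate the upper, lower and symmetric topologies. The element $a$ is bounded if for every $v\in\mathscr{V}$ there are $\lambda,\rho>0$ with $a\leqslant\lambda v$ and $0\leqslant a+\rho v$. The closure of $a$ is $\overline{a}=\bigcap_{v\in\mathscr{V}}v(a)$; $(\mathscr{P},\mathscr{V})$ is separated if $\overline a=\overline b$ implies $a=b$. A net $(a_i)$ converges to $a$ in the symmetric topology if for every $v\in\mathscr{V}$ there is $i_0$ with $a_i\leqslant a+v$ and $a\leqslant a_i+v$ for all $i\ge i_0$; it is Cauchy if for every $v\in\mathscr{V}$ there is $i_0$ with $a_i\leqslant a_j+v$ for all $i,j\ge i_0$. The cone is complete (with respect to the symmetric topology) if every Cauchy net converges to an element of $\mathscr{P}$ in the symmetric topology. A mapping $A$ is additive if $A(x+y)=A(x)+A(y)$ for all $x,y$. *)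

theory Defs
  imports Complex_Main "HOL-Library.FuncSet"
begin

text \<open>
  In the style of the library's \<open>vector_space\<close>, a full cone is a whole type of class
  \<open>comm_monoid_add\<close> with a scalar multiplication, of which only the values at scalars
  \<open>\<ge> 0\<close> are constrained. Subcones are subsets of that type. The class provides no
  cancellation law.
\<close>

locale abstract_cone =
  fixes scale :: "real \<Rightarrow> 'a::comm_monoid_add \<Rightarrow> 'a" (infixr "\<odot>" 75)
  assumes scale_scale: "0 \<le> r \<Longrightarrow> 0 \<le> s \<Longrightarrow> r \<odot> (s \<odot> a) = (r * s) \<odot> a"
    and scale_add_left: "0 \<le> r \<Longrightarrow> 0 \<le> s \<Longrightarrow> (r + s) \<odot> a = r \<odot> a + s \<odot> a"
    and scale_add_right: "0 \<le> r \<Longrightarrow> r \<odot> (a + b) = r \<odot> a + r \<odot> b"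
    and scale_one: "1 \<odot> a = a"
    and scale_zero: "0 \<odot> a = 0"

locale preordered_cone = abstract_cone scale
  for scale :: "real \<Rightarrow> 'a::comm_monoid_add \<Rightarrow> 'a" (infixr "\<odot>" 75) +
  fixes le :: "'a \<Rightarrow> 'a \<Rightarrow> bool" (infix "\<preceq>" 50)
  assumes le_refl: "a \<preceq> a"
    and le_trans: "a \<preceq> b \<Longrightarrow> b \<preceq> c \<Longrightarrow> a \<preceq> c"
    and le_add: "a \<preceq> b \<Longrightarrow> a + c \<preceq> b + c"
    and le_scale: "a \<preceq> b \<Longrightarrow> 0 \<le> r \<Longrightarrow> r \<odot> a \<preceq> r \<odot> b"

locale full_locally_convex_cone = preordered_cone scale le
  for scale :: "real \<Rightarrow> 'a::comm_monoid_add \<Rightarrow> 'a" (infixr "\<odot>" 75)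
    and le :: "'a \<Rightarrow> 'a \<Rightarrow> bool" (infix "\<preceq>" 50) +
  fixes V :: "'a set"
  assumes nbhd_pos: "v \<in> V \<Longrightarrow> 0 \<preceq> v \<and> v \<noteq> 0"
    and nbhd_directed: "u \<in> V \<Longrightarrow> v \<in> V \<Longrightarrow> \<exists>w\<in>V. w \<preceq> u \<and> w \<preceq> v"
    and nbhd_add: "u \<in> V \<Longrightarrow> v \<in> V \<Longrightarrow> u + v \<in> V"
    and nbhd_scale: "v \<in> V \<Longrightarrow> 0 < r \<Longrightarrow> r \<odot> v \<in> V"
    and bounded_below: "v \<in> V \<Longrightarrow> \<exists>r>0. 0 \<preceq> a + r \<odot> v"

text \<open>A locally convex cone \<open>(P, V)\<close>; \<open>V\<close> lives in the ambient full cone, not in \<open>P\<close>.\<close>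

locale locally_convex_cone = full_locally_convex_cone scale le V
  for scale :: "real \<Rightarrow> 'a::comm_monoid_add \<Rightarrow> 'a" (infixr "\<odot>" 75)
    and le :: "'a \<Rightarrow> 'a \<Rightarrow> bool" (infix "\<preceq>" 50)
    and V :: "'a set" +
  fixes P :: "'a set"
  assumes subcone_zero: "0 \<in> P"
    and subcone_add: "a \<in> P \<Longrightarrow> b \<in> P \<Longrightarrow> a + b \<in> P"
    and subcone_scale: "a \<in> P \<Longrightarrow> 0 \<le> r \<Longrightarrow> r \<odot> a \<in> P"

definition upper_nbhd :: "('a::plus \<Rightarrow> 'a \<Rightarrow> bool) \<Rightarrow> 'a set \<Rightarrow> 'a \<Rightarrow> 'a \<Rightarrow> 'a set" where
  "upper_nbhd le P v a = {b \<in> P. le b (a + v)}"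

definition lower_nbhd :: "('a::plus \<Rightarrow> 'a \<Rightarrow> bool) \<Rightarrow> 'a set \<Rightarrow> 'a \<Rightarrow> 'a \<Rightarrow> 'a set" where
  "lower_nbhd le P v a = {b \<in> P. le a (b + v)}"

definition sym_nbhd :: "('a::plus \<Rightarrow> 'a \<Rightarrow> bool) \<Rightarrow> 'a set \<Rightarrow> 'a \<Rightarrow> 'a \<Rightarrow> 'a set" where
  "sym_nbhd le P v a = upper_nbhd le P v a \<inter> lower_nbhd le P v a"

definition bounded_element ::
  "(real \<Rightarrow> 'a::comm_monoid_add \<Rightarrow> 'a) \<Rightarrow> ('a \<Rightarrow> 'a \<Rightarrow> bool) \<Rightarrow> 'a set \<Rightarrow> 'a \<Rightarrow> bool" where
  "bounded_element scale le V a \<longleftrightarrow>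
     (\<forall>v\<in>V. \<exists>r>0. \<exists>s>0. le a (scale r v) \<and> le 0 (a + scale s v))"

definition cone_closure :: "('a::plus \<Rightarrow> 'a \<Rightarrow> bool) \<Rightarrow> 'a set \<Rightarrow> 'a set \<Rightarrow> 'a \<Rightarrow> 'a set" where
  "cone_closure le P V a = P \<inter> (\<Inter>v\<in>V. upper_nbhd le P v a)"

definition separated_cone :: "('a::plus \<Rightarrow> 'a \<Rightarrow> bool) \<Rightarrow> 'a set \<Rightarrow> 'a set \<Rightarrow> bool" where
  "separated_cone le P V \<longleftrightarrow>
     (\<forall>a\<in>P. \<forall>b\<in>P. cone_closure le P V a = cone_closure le P V b \<longrightarrow> a = b)"

definition directed_index :: "'i set \<Rightarrow> ('i \<Rightarrow> 'i \<Rightarrow> bool) \<Rightarrow> bool" where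
  "directed_index I ord \<longleftrightarrow> I \<noteq> {} \<and>
     (\<forall>i\<in>I. ord i i) \<and>
     (\<forall>i\<in>I. \<forall>j\<in>I. \<forall>k\<in>I. ord i j \<longrightarrow> ord j k \<longrightarrow> ord i k) \<and>
     (\<forall>i\<in>I. \<forall>j\<in>I. \<exists>k\<in>I. ord i k \<and> ord j k)"

definition sym_converges ::
  "('a::plus \<Rightarrow> 'a \<Rightarrow> bool) \<Rightarrow> 'a set \<Rightarrow> 'i set \<Rightarrow> ('i \<Rightarrow> 'i \<Rightarrow> bool) \<Rightarrow> ('i \<Rightarrow> 'a) \<Rightarrow> 'a \<Rightarrow> bool" where
  "sym_converges le V I ord x a \<longleftrightarrow>
     (\<forall>v\<in>V. \<exists>i0\<in>I. \<forall>i\<in>I. ord i0 i \<longrightarrow> le (x i) (a + v) \<and> le a (x i + v))"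

definition sym_cauchy ::
  "('a::plus \<Rightarrow> 'a \<Rightarrow> bool) \<Rightarrow> 'a set \<Rightarrow> 'i set \<Rightarrow> ('i \<Rightarrow> 'i \<Rightarrow> bool) \<Rightarrow> ('i \<Rightarrow> 'a) \<Rightarrow> bool" where
  "sym_cauchy le V I ord x \<longleftrightarrow>
     (\<forall>v\<in>V. \<exists>i0\<in>I. \<forall>i\<in>I. \<forall>j\<in>I. ord i0 i \<longrightarrow> ord i0 j \<longrightarrow> le (x i) (x j + v))"

text \<open>
  A definition cannot quantify over all index types. The index sets here are the subsets of
  \<open>'a \<times> 'a set\<close>; \<open>sym_complete_net\<close> below shows that this already yields convergence of
  Cauchy nets over arbitrary index types.
\<close>

definition sym_complete :: "('a::plus \<Rightarrow> 'a \<Rightarrow> bool) \<Rightarrow> 'a set \<Rightarrow> 'a set \<Rightarrow> bool" where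
  "sym_complete le P V \<longleftrightarrow>
     (\<forall>(I :: ('a \<times> 'a set) set) ord x.
        directed_index I ord \<longrightarrow> x \<in> I \<rightarrow> P \<longrightarrow> sym_cauchy le V I ord x \<longrightarrow>
        (\<exists>a\<in>P. sym_converges le V I ord x a))"

lemma sym_complete_net:
  fixes I :: "'i set" and le :: "'a::plus \<Rightarrow> 'a \<Rightarrow> bool"
  assumes compl: "sym_complete le P V"
    and dir: "directed_index I ord"
    and xP: "x \<in> I \<rightarrow> P"
    and cau: "sym_cauchy le V I ord x"
  shows "\<exists>a\<in>P. sym_converges le V I ord x a"
proof -
  define T where "T i = x ` {j \<in> I. ord i j}" for i
  define J where "J = {(y, S). \<exists>i\<in>I. S = T i \<and> y \<in> S}"
  define ordJ :: "'a \<times> 'a set \<Rightarrow> 'a \<times> 'a set \<Rightarrow> bool" where "ordJ p q \<longleftrightarrow> snd q \<subseteq> snd p" for p q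
  from dir have ne: "I \<noteq> {}" and rfl: "\<And>i. i \<in> I \<Longrightarrow> ord i i"
    and trn: "\<And>i j k. i \<in> I \<Longrightarrow> j \<in> I \<Longrightarrow> k \<in> I \<Longrightarrow> ord i j \<Longrightarrow> ord j k \<Longrightarrow> ord i k"
    and ub: "\<And>i j. i \<in> I \<Longrightarrow> j \<in> I \<Longrightarrow> \<exists>k\<in>I. ord i k \<and> ord j k"
    unfolding directed_index_def by blast+
  have J_mem: "(x i, T i) \<in> J" if "i \<in> I" for i
    using that rfl unfolding J_def T_def by blast
  have T_mono: "T k \<subseteq> T i" if "i \<in> I" "k \<in> I" "ord i k" for i k
    using that trn unfolding T_def by blast
  have "directed_index J ordJ"
    unfolding directed_index_def
  proof (intro conjI ballI impI)
    show "J \<noteq> {}" using ne J_mem by blast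
  next
    fix p q assume "p \<in> J" "q \<in> J"
    then obtain i j where "i \<in> I" "j \<in> I" "snd p = T i" "snd q = T j"
      unfolding J_def by auto
    moreover from this obtain k where "k \<in> I" "ord i k" "ord j k" using ub by blast
    ultimately show "\<exists>r\<in>J. ordJ p r \<and> ordJ q r"
      using J_mem T_mono unfolding ordJ_def by (metis snd_conv)
  qed (auto simp: ordJ_def)
  moreover have "fst \<in> J \<rightarrow> P"
    using xP unfolding J_def T_def by auto
  moreover have "sym_cauchy le V J ordJ fst"
    unfolding sym_cauchy_def
  proof
    fix v assume "v \<in> V"
    then obtain i0 where i0: "i0 \<in> I"
      "\<And>i j. i \<in> I \<Longrightarrow> j \<in> I \<Longrightarrow> ord i0 i \<Longrightarrow> ord i0 j \<Longrightarrow> le (x i) (x j + v)"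
      using cau unfolding sym_cauchy_def by blast
    have "le (fst p) (fst q + v)"
      if "p \<in> J" "q \<in> J" "ordJ (x i0, T i0) p" "ordJ (x i0, T i0) q" for p q
    proof -
      have "fst p \<in> T i0" "fst q \<in> T i0"
        using that unfolding J_def ordJ_def by auto
      then show ?thesis using i0(2) unfolding T_def by auto
    qed
    then show "\<exists>p0\<in>J. \<forall>p\<in>J. \<forall>q\<in>J. ordJ p0 p \<longrightarrow> ordJ p0 q \<longrightarrow> le (fst p) (fst q + v)"
      using J_mem[OF i0(1)] by blast
  qed
  ultimately obtain a where a: "a \<in> P" "sym_converges le V J ordJ fst a"
    using compl unfolding sym_complete_def by blast
  have "sym_converges le V I ord x a"
    unfolding sym_converges_def
  proof
    fix v assume "v \<in> V"
    then obtain p0 where p0: "p0 \<in> J"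
      "\<And>p. p \<in> J \<Longrightarrow> ordJ p0 p \<Longrightarrow> le (fst p) (a + v) \<and> le a (fst p + v)"
      using a(2) unfolding sym_converges_def by blast
    then obtain i0 where i0: "i0 \<in> I" "snd p0 = T i0" unfolding J_def by auto
    have "le (x i) (a + v) \<and> le a (x i + v)" if "i \<in> I" "ord i0 i" for i
      using p0(2)[OF J_mem[OF that(1)]] T_mono[OF i0(1) that] i0(2)
      by (simp add: ordJ_def)
    then show "\<exists>i0\<in>I. \<forall>i\<in>I. ord i0 i \<longrightarrow> le (x i) (a + v) \<and> le a (x i + v)"
      using i0(1) by blast
  qed
  with a(1) show ?thesis by blast
qed

definition additive_on :: "'a::plus set \<Rightarrow> ('a \<Rightarrow> 'b::plus) \<Rightarrow> bool" where
  "additive_on P A \<longleftrightarrow> (\<forall>x\<in>P. \<forall>y\<in>P. A (x + y) = A x + A y)"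

end

theory Submission
  imports Defs
begin

text \<open>
  Since \<open>f 0\<close> is bounded and every element is bounded below, \<open>g 0\<close> and \<open>h 0\<close> lie within a
  multiple of \<open>v\<close> of \<open>0\<close>. Hence \<open>g\<close> and \<open>h\<close> stay within a fixed multiple of \<open>v\<close> of \<open>f\<close>, and \<open>f\<close>
  is additive up to a fixed multiple of \<open>v\<close>. Hyers' method then applies: the sequence
  \<open>f (2^n x) / 2^n\<close> is Cauchy, because the bounded element \<open>v\<close> is absorbed by every neighborhood,
  and its limit is the additive mapping. Two additive mappings at distance at most \<open>K v\<close> are, by
  doubling, at distance at most \<open>(K / 2^n) v\<close> for every \<open>n\<close>, so they agree by separatedness.
\<close>

section \<open>Calculus of symmetric closeness measured in multiples of a fixed element\<close>

context preordered_cone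
begin

text \<open>The radius is a real number, separate from \<open>v\<close>, so that errors along a
  chain of estimates add up by real arithmetic.\<close>

definition close :: "'a \<Rightarrow> real \<Rightarrow> 'a \<Rightarrow> 'a \<Rightarrow> bool" where
  "close v r a b \<longleftrightarrow> a \<preceq> b + r \<odot> v \<and> b \<preceq> a + r \<odot> v"

lemma sym_nbhd_iff_close: "b \<in> sym_nbhd (\<preceq>) UNIV (r \<odot> v) a \<longleftrightarrow> close v r b a"
  unfolding sym_nbhd_def upper_nbhd_def lower_nbhd_def close_def by auto

lemma le_add_mono: "a \<preceq> b \<Longrightarrow> c \<preceq> d \<Longrightarrow> a + c \<preceq> b + d"
  using le_trans[OF le_add[of a b c]] le_add[of c d b] by (simp add: add.commute)

lemma le_add_trans: "a \<preceq> b + c \<Longrightarrow> c \<preceq> d \<Longrightarrow> a \<preceq> b + d"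
  by (rule le_trans[OF _ le_add_mono[OF le_refl]])

text \<open>Follows by writing \<open>0\<close> as \<open>0 \<odot> a\<close> and multiplying the
  scalars.\<close>

lemma scale_right_zero: "0 \<le> r \<Longrightarrow> r \<odot> 0 = 0"
  by (metis mult_zero_right order_refl scale_scale scale_zero)

lemma scale_nonneg: "0 \<preceq> v \<Longrightarrow> 0 \<le> r \<Longrightarrow> 0 \<preceq> r \<odot> v"
  using le_scale[of 0 v r] scale_right_zero by simp

lemma scale_left_mono:
  assumes "0 \<preceq> v" "0 \<le> r" "r \<le> s"
  shows "r \<odot> v \<preceq> s \<odot> v"
proof -
  have "r \<odot> v + 0 \<preceq> r \<odot> v + (s - r) \<odot> v"
    using assms by (intro le_add_mono le_refl scale_nonneg) auto
  moreover have "r \<odot> v + (s - r) \<odot> v = s \<odot> v"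
    using assms scale_add_left[of r "s - r" v] by simp
  ultimately show ?thesis by simp
qed

lemma close_commute: "close v r a b \<longleftrightarrow> close v r b a"
  unfolding close_def by blast

lemma close_refl: "0 \<preceq> v \<Longrightarrow> 0 \<le> r \<Longrightarrow> close v r a a"
  unfolding close_def using le_add_mono[OF le_refl scale_nonneg, of v r a] by simp

lemma close_trans:
  assumes "close v r a b" "close v s b c" "0 \<le> r" "0 \<le> s"
  shows "close v (r + s) a c"
proof -
  have "a \<preceq> (c + s \<odot> v) + r \<odot> v" "c \<preceq> (a + r \<odot> v) + s \<odot> v"
    using assms(1,2) unfolding close_def by (blast intro: le_trans[OF _ le_add])+
  then show ?thesis
    using assms(3,4) unfolding close_def by (simp add: scale_add_left ac_simps)
qed

lemma close_add:
  assumes "close v r a b" "close v s c d" "0 \<le> r" "0 \<le> s"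
  shows "close v (r + s) (a + c) (b + d)"
proof -
  have "a + c \<preceq> (b + r \<odot> v) + (d + s \<odot> v)" "b + d \<preceq> (a + r \<odot> v) + (c + s \<odot> v)"
    using assms(1,2) unfolding close_def by (auto intro: le_add_mono)
  then show ?thesis
    using assms(3,4) unfolding close_def by (simp add: scale_add_left ac_simps)
qed

lemma close_scale:
  assumes "close v r a b" "0 \<le> r" "0 \<le> s"
  shows "close v (s * r) (s \<odot> a) (s \<odot> b)"
  using assms le_scale[of a "b + r \<odot> v" s] le_scale[of b "a + r \<odot> v" s]
  unfolding close_def by (simp add: scale_add_right scale_scale)

lemma close_mono:
  assumes "close v r a b" "0 \<preceq> v" "0 \<le> r" "r \<le> s"
  shows "close v s a b"
  using assms(1) le_add_trans[OF _ scale_left_mono[OF assms(2-4)]] unfolding close_def by simp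

lemma scale_two: "2 \<odot> a = a + a"
  using scale_add_left[of 1 1 a] by (simp add: scale_one)

text \<open>The step errors form a geometric series whose tail from index \<open>m\<close> on has
  sum \<open>M / 2 ^ m\<close>.\<close>

lemma close_double_sequence:
  assumes "0 \<preceq> v" "0 \<le> M" and step: "\<And>n. close v (M / 2 ^ Suc n) (a n) (a (Suc n))"
  shows "close v (M / 2 ^ m) (a m) (a (m + k))"
proof -
  \<comment> \<open>The induction carries the exact partial sum; the bound \<open>M / 2 ^ m\<close>
    alone leaves no room for the next step.\<close>
  have "close v (M / 2 ^ m - M / 2 ^ (m + k)) (a m) (a (m + k))"
  proof (induction k)
    case 0
    show ?case using assms(1) by (simp add: close_refl)
  next
    case (Suc k)
    have "M / 2 ^ (m + k) \<le> M / 2 ^ m"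
      using assms(2) by (intro divide_left_mono) auto
    then have "close v ((M / 2 ^ m - M / 2 ^ (m + k)) + M / 2 ^ Suc (m + k)) (a m) (a (Suc (m + k)))"
      using assms(2) by (intro close_trans[OF Suc.IH step]) auto
    then show ?case by (simp add: field_simps)
  qed
  moreover have "M / 2 ^ (m + k) \<le> M / 2 ^ m"
    using assms(2) by (intro divide_left_mono) auto
  ultimately show ?thesis
    using assms(1,2) by (elim close_mono) auto
qed

end

section \<open>Absorption by neighborhoods, bounds near zero, and limits\<close>

context full_locally_convex_cone
begin

text \<open>Boundedness gives \<open>v \<preceq> l \<odot> u\<close>, and
  \<open>C * l / 2 ^ m\<close> is at most 1 for large \<open>m\<close>. This turns geometric errors
  in \<open>v\<close> into estimates for every neighborhood.\<close>

lemma bounded_absorbed: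
  assumes "bounded_element (\<odot>) (\<preceq>) V v" "u \<in> V" "0 \<le> C"
  shows "\<exists>n::nat. \<forall>m\<ge>n. (C / 2 ^ m) \<odot> v \<preceq> u"
proof -
  obtain l where l: "l > 0" "v \<preceq> l \<odot> u"
    using assms(1,2) unfolding bounded_element_def by blast
  obtain n where n: "C * l < 2 ^ n"
    using real_arch_pow[of 2 "C * l"] by auto
  have "(C / 2 ^ m) \<odot> v \<preceq> u" if "n \<le> m" for m
  proof -
    have "(2::real) ^ n \<le> 2 ^ m" using that by simp
    with n have "C * l \<le> 2 ^ m" by linarith
    then have le1: "C * l / 2 ^ m \<le> 1" by simp
    have "(C / 2 ^ m) \<odot> v \<preceq> (C / 2 ^ m) \<odot> l \<odot> u"
      using l assms(3) by (intro le_scale) auto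
    also have "(C / 2 ^ m) \<odot> l \<odot> u = (C * l / 2 ^ m) \<odot> u"
      using l assms(3) by (simp add: scale_scale)
    finally have "(C / 2 ^ m) \<odot> v \<preceq> (C * l / 2 ^ m) \<odot> u" .
    moreover have "(C * l / 2 ^ m) \<odot> u \<preceq> u"
      using scale_left_mono[of u "C * l / 2 ^ m" 1] le1 l assms(2,3) nbhd_pos
      by (simp add: scale_one)
    ultimately show ?thesis using le_trans by blast
  qed
  then show ?thesis by blast
qed

text \<open>Boundedness below replaces cancellation: adding
  \<open>0 \<preceq> b + t \<odot> v\<close> to \<open>a\<close> bounds \<open>a\<close> by
  \<open>a + b\<close> up to a multiple of \<open>v\<close>. The lower bound of \<open>a\<close>
  itself supplies the other inequality.\<close>

lemma close_zero_of_add_le: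
  assumes "v \<in> V" "0 \<le> r" and ab: "a + b \<preceq> r \<odot> v"
  shows "\<exists>c>0. close v c a 0"
proof -
  have v0: "0 \<preceq> v" using nbhd_pos \<open>v \<in> V\<close> by blast
  obtain s where s: "s > 0" "0 \<preceq> a + s \<odot> v"
    using bounded_below[OF \<open>v \<in> V\<close>] by blast
  obtain t where t: "t > 0" "0 \<preceq> b + t \<odot> v"
    using bounded_below[OF \<open>v \<in> V\<close>] by blast
  have "a \<preceq> (a + b) + t \<odot> v"
    using le_add_mono[OF le_refl t(2), of a] by (simp add: add.assoc)
  moreover have "(a + b) + t \<odot> v \<preceq> (r + t) \<odot> v"
    using le_add[OF ab] t \<open>0 \<le> r\<close> by (simp add: scale_add_left)
  moreover have "(r + t) \<odot> v \<preceq> (r + s + t) \<odot> v" "s \<odot> v \<preceq> (r + s + t) \<odot> v"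
    using v0 s t \<open>0 \<le> r\<close> by (auto intro: scale_left_mono)
  ultimately have "a \<preceq> (r + s + t) \<odot> v" "0 \<preceq> a + (r + s + t) \<odot> v"
    by (blast intro: le_trans, blast intro: le_add_trans[OF s(2)])
  then have "close v (r + s + t) a 0" unfolding close_def by simp
  moreover have "r + s + t > 0" using s t \<open>0 \<le> r\<close> by simp
  ultimately show ?thesis by blast
qed

lemma separated_close_eq:
  assumes sep: "separated_cone (\<preceq>) UNIV V" and bdd: "bounded_element (\<odot>) (\<preceq>) V v" and "0 \<le> C"
    and cl: "\<And>n. close v (C / 2 ^ n) a b"
  shows "a = b"
proof -
  have closure_sub: "cone_closure (\<preceq>) UNIV V a \<subseteq> cone_closure (\<preceq>) UNIV V b"
    if ab: "\<And>n. close v (C / 2 ^ n) a b" for a b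
  proof
    fix c assume c: "c \<in> cone_closure (\<preceq>) UNIV V a"
    have "c \<preceq> b + u" if "u \<in> V" for u
    proof -
      \<comment> \<open>One half of \<open>u\<close> is spent on passing from \<open>c\<close> to
        \<open>a\<close>, the other on passing from \<open>a\<close> to \<open>b\<close>.\<close>
      let ?w = "(1 / 2) \<odot> u"
      have w: "?w \<in> V" using that nbhd_scale by simp
      obtain n where "(C / 2 ^ n) \<odot> v \<preceq> ?w"
        using bounded_absorbed[OF bdd w \<open>0 \<le> C\<close>] by blast
      then have "a \<preceq> b + ?w"
        using ab[of n] unfolding close_def by (blast intro: le_add_trans)
      moreover have "c \<preceq> a + ?w"
        using c w unfolding cone_closure_def upper_nbhd_def by blast
      ultimately have "c \<preceq> (b + ?w) + ?w" by (blast intro: le_trans[OF _ le_add])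
      moreover have "?w + ?w = u"
        using scale_add_left[of "1 / 2" "1 / 2" u] by (simp add: scale_one)
      ultimately show ?thesis by (simp add: add.assoc)
    qed
    then show "c \<in> cone_closure (\<preceq>) UNIV V b"
      unfolding cone_closure_def upper_nbhd_def by blast
  qed
  have "cone_closure (\<preceq>) UNIV V a = cone_closure (\<preceq>) UNIV V b"
    using closure_sub cl close_commute by (meson subset_antisym)
  with sep show ?thesis unfolding separated_cone_def by blast
qed

lemma complete_close_limit:
  assumes compl: "sym_complete (\<preceq>) UNIV V" and "v \<in> V"
    and bdd: "bounded_element (\<odot>) (\<preceq>) V v" and M: "0 \<le> M"
    and step: "\<And>n. close v (M / 2 ^ Suc n) (a n) (a (Suc n))"
  shows "\<exists>l. \<forall>n. close v ((M + 1) / 2 ^ n) l (a n)"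
proof -
  have v0: "0 \<preceq> v" using nbhd_pos \<open>v \<in> V\<close> by blast
  have near: "close v (M / 2 ^ m) (a m) (a n)" if "m \<le> n" for m n
    using close_double_sequence[where a = a and m = m and k = "n - m", OF v0 M step] that by simp
  have "sym_cauchy (\<preceq>) V (UNIV :: nat set) (\<le>) a"
    unfolding sym_cauchy_def
  proof
    fix u assume "u \<in> V"
    \<comment> \<open>The factor 2 arises because \<open>a i\<close> and \<open>a j\<close> are
      compared through \<open>a n\<close>.\<close>
    then obtain n where n: "(2 * M / 2 ^ n) \<odot> v \<preceq> u"
      using bounded_absorbed[OF bdd, of u "2 * M"] M by auto
    have "a i \<preceq> a j + u" if "n \<le> i" "n \<le> j" for i j
    proof -
      have "close v (M / 2 ^ n + M / 2 ^ n) (a i) (a j)"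
        using near[OF that(1)] near[OF that(2)] M
        by (intro close_trans[of _ _ _ "a n"]) (simp_all add: close_commute)
      then show ?thesis
        using le_add_trans[OF _ n] unfolding close_def by simp
    qed
    then show "\<exists>i0\<in>UNIV. \<forall>i\<in>UNIV. \<forall>j\<in>UNIV. i0 \<le> i \<longrightarrow> i0 \<le> j \<longrightarrow> a i \<preceq> a j + u"
      by blast
  qed
  moreover have "directed_index (UNIV :: nat set) (\<le>)"
    unfolding directed_index_def by (auto intro: max.cobounded1 max.cobounded2)
  ultimately obtain l where l: "sym_converges (\<preceq>) V (UNIV :: nat set) (\<le>) a l"
    using sym_complete_net[OF compl] by blast
  have "close v ((M + 1) / 2 ^ n) l (a n)" for n
  proof -
    \<comment> \<open>Convergence is tested on this neighborhood, which accounts for the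
      \<open>+ 1\<close> in the radius.\<close>
    have "(1 / 2 ^ n) \<odot> v \<in> V" using \<open>v \<in> V\<close> nbhd_scale by simp
    then obtain i0 where i0: "\<And>i. i0 \<le> i \<Longrightarrow> close v (1 / 2 ^ n) l (a i)"
      using l unfolding sym_converges_def close_def by blast
    \<comment> \<open>The intermediate index \<open>max i0 n\<close> is late enough both for
      convergence and for comparison with \<open>a n\<close>.\<close>
    have "close v (1 / 2 ^ n + M / 2 ^ n) l (a n)"
      using i0[of "max i0 n"] near[of n "max i0 n"] M
      by (intro close_trans[of _ _ _ "a (max i0 n)"]) (auto simp: close_commute)
    then show ?thesis by (simp add: add_divide_distrib add.commute)
  qed
  then show ?thesis by blast
qed

section \<open>Uniqueness and existence of an additive mapping near a given one\<close>

lemma additive_close_unique: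
  fixes A B :: "'c::comm_monoid_add \<Rightarrow> 'a"
  assumes sep: "separated_cone (\<preceq>) UNIV V" and bdd: "bounded_element (\<odot>) (\<preceq>) V v" and K: "0 \<le> K"
    and P_add: "\<And>x y. x \<in> P \<Longrightarrow> y \<in> P \<Longrightarrow> x + y \<in> P"
    and A: "additive_on P A" and B: "additive_on P B"
    and cl: "\<And>x. x \<in> P \<Longrightarrow> close v K (A x) (B x)" and "x \<in> P"
  shows "A x = B x"
proof (rule separated_close_eq[OF sep bdd K])
  fix n
  show "close v (K / 2 ^ n) (A x) (B x)"
    using \<open>x \<in> P\<close>
  proof (induction n arbitrary: x)
    case 0
    then show ?case using cl by simp
  next
    case (Suc n)
    \<comment> \<open>The induction hypothesis is taken at \<open>x + x\<close>, where additivity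
      doubles both values; scaling by 1/2 then halves the radius.\<close>
    have "close v (K / 2 ^ n) (2 \<odot> A x) (2 \<odot> B x)"
      using Suc.IH[of "x + x"] Suc.prems P_add A B by (simp add: additive_on_def scale_two)
    from close_scale[OF this, of "1 / 2"] K show ?case
      by (simp add: scale_scale scale_one mult.commute)
  qed
qed

lemma hyers_additive:
  fixes f :: "'c::comm_monoid_add \<Rightarrow> 'a"
  assumes sep: "separated_cone (\<preceq>) UNIV V" and compl: "sym_complete (\<preceq>) UNIV V"
    and "v \<in> V" and bdd: "bounded_element (\<odot>) (\<preceq>) V v" and M: "0 \<le> M"
    and P_add: "\<And>x y. x \<in> P \<Longrightarrow> y \<in> P \<Longrightarrow> x + y \<in> P"
    and cl: "\<And>x y. x \<in> P \<Longrightarrow> y \<in> P \<Longrightarrow> close v M (f (x + y)) (f x + f y)"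
  shows "\<exists>A. additive_on P A \<and> (\<forall>x\<in>P. close v (M + 1) (A x) (f x))"
proof -
  \<comment> \<open>\<open>d n x\<close> is \<open>2^n x\<close> built from addition alone, the only
    operation at hand on \<open>'c\<close>.\<close>
  define d where "d n = ((\<lambda>x::'c. x + x) ^^ n)" for n
  define a where "a n x = (1 / 2 ^ n) \<odot> f (d n x)" for n x
  have d_P: "d n x \<in> P" if "x \<in> P" for n x
    using that P_add unfolding d_def by (induction n) auto
  have d_add: "d n (x + y) = d n x + d n y" for n x y
    unfolding d_def by (induction n) (auto simp: ac_simps)
  have step: "close v (M / 2 ^ Suc n) (a n x) (a (Suc n) x)" if "x \<in> P" for n x
  proof -
    have "close v M (2 \<odot> f (d n x)) (f (d (Suc n) x))"
      using cl[OF d_P d_P, OF that that] by (simp add: close_commute scale_two d_def)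
    from close_scale[OF this M, of "1 / 2 ^ Suc n"] show ?thesis
      by (simp add: a_def scale_scale)
  qed
  have "\<exists>l. \<forall>n. close v ((M + 1) / 2 ^ n) l (a n x)" if "x \<in> P" for x
    using complete_close_limit[where a = "\<lambda>n. a n x", OF compl \<open>v \<in> V\<close> bdd M step[OF that]] .
  then obtain A where A: "\<And>x n. x \<in> P \<Longrightarrow> close v ((M + 1) / 2 ^ n) (A x) (a n x)"
    by metis
  have "A (x + y) = A x + A y" if xy: "x \<in> P" "y \<in> P" for x y
  proof (rule separated_close_eq[OF sep bdd])
    \<comment> \<open>The summands are the costs, up to \<open>1 / 2 ^ n\<close>, of replacing
      \<open>A (x + y)\<close> by \<open>a n (x + y)\<close>, splitting that into
      \<open>a n x + a n y\<close>, and returning to \<open>A x\<close> and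
      \<open>A y\<close>.\<close>
    show "0 \<le> (M + 1) + M + ((M + 1) + (M + 1))" using M by simp
    fix n
    have "close v (1 / 2 ^ n * M) (a n (x + y)) (a n x + a n y)"
      using close_scale[OF cl[OF d_P d_P, OF xy] M, of "1 / 2 ^ n" n n]
      by (simp add: a_def d_add scale_add_right)
    moreover have "close v ((M + 1) / 2 ^ n + (M + 1) / 2 ^ n) (a n x + a n y) (A x + A y)"
      using A xy M by (intro close_add) (auto simp: close_commute)
    moreover have "close v ((M + 1) / 2 ^ n) (A (x + y)) (a n (x + y))"
      using A P_add xy by blast
    ultimately have "close v ((M + 1) / 2 ^ n + (1 / 2 ^ n * M + ((M + 1) / 2 ^ n + (M + 1) / 2 ^ n)))
        (A (x + y)) (A x + A y)"
      using M by (intro close_trans[OF _ close_trans]) auto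
    then show "close v (((M + 1) + M + ((M + 1) + (M + 1))) / 2 ^ n) (A (x + y)) (A x + A y)"
      by (simp add: add_divide_distrib add.assoc)
  qed
  \<comment> \<open>The approximant of index 0 is \<open>f x\<close> itself.\<close>
  moreover have "close v (M + 1) (A x) (f x)" if "x \<in> P" for x
    using A[OF that, of 0] by (simp add: a_def d_def scale_one)
  ultimately show ?thesis unfolding additive_on_def by blast
qed

section \<open>Reduction from three mappings to approximate additivity of \<open>f\<close>\<close>

lemma pexider_near_additive:
  fixes f g h :: "'c::comm_monoid_add \<Rightarrow> 'a"
  assumes "v \<in> V" and "0 \<in> P"
    and P_add: "\<And>x y. x \<in> P \<Longrightarrow> y \<in> P \<Longrightarrow> x + y \<in> P"
    and cl: "\<And>x y. x \<in> P \<Longrightarrow> y \<in> P \<Longrightarrow> close v 1 (f (x + y)) (g x + h y)"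
    and f0: "bounded_element (\<odot>) (\<preceq>) V (f 0)"
  shows "\<exists>M\<ge>0. \<forall>x\<in>P. \<forall>y\<in>P. close v M (f (x + y)) (f x + f y)"
proof -
  have v0: "0 \<preceq> v" using nbhd_pos \<open>v \<in> V\<close> by blast
  obtain r where r: "r > 0" "f 0 \<preceq> r \<odot> v"
    using f0 \<open>v \<in> V\<close> unfolding bounded_element_def by blast
  have "g 0 + h 0 \<preceq> f 0 + 1 \<odot> v"
    using cl[OF \<open>0 \<in> P\<close> \<open>0 \<in> P\<close>] unfolding close_def by simp
  then have gh0: "g 0 + h 0 \<preceq> (r + 1) \<odot> v"
    using r le_trans[OF _ le_add[OF r(2)]] by (simp add: scale_add_left)
  \<comment> \<open>The upper bound on the sum \<open>g 0 + h 0\<close> controls each summand in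
    turn.\<close>
  obtain c where c: "c > 0" "close v c (g 0) 0"
    using close_zero_of_add_le[OF \<open>v \<in> V\<close> _ gh0] r by auto
  obtain e where e: "e > 0" "close v e (h 0) 0"
    using close_zero_of_add_le[OF \<open>v \<in> V\<close> _ gh0[unfolded add.commute[of "g 0"]]] r by auto
  have fg: "close v (1 + e) (f x) (g x)" if "x \<in> P" for x
    \<comment> \<open>Setting \<open>y = 0\<close> costs 1, and dropping \<open>h 0\<close> costs
      \<open>e\<close>.\<close>
    using close_trans[OF cl[OF that \<open>0 \<in> P\<close>], of "0 + e" "g x"]
      close_add[OF close_refl[OF v0, of 0] e(2), of "g x"] e by simp
  have fh: "close v (1 + c) (f x) (h x)" if "x \<in> P" for x
    using close_trans[OF cl[OF \<open>0 \<in> P\<close> that], of "c + 0" "h x"]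
      close_add[OF c(2) close_refl[OF v0, of 0], of "h x"] c by simp
  \<comment> \<open>The hypothesis contributes 1; replacing \<open>g x\<close> by \<open>f x\<close>
    and \<open>h y\<close> by \<open>f y\<close> contributes \<open>1 + e\<close> and
    \<open>1 + c\<close>.\<close>
  have "close v (1 + ((1 + e) + (1 + c))) (f (x + y)) (f x + f y)" if "x \<in> P" "y \<in> P" for x y
    using fg[OF that(1)] fh[OF that(2)] c e
    by (intro close_trans[OF cl[OF that]] close_add) (auto simp: close_commute)
  then show ?thesis using c e by (intro exI[of _ "1 + ((1 + e) + (1 + c))"]) auto
qed

end

section \<open>Assembly of existence and uniqueness\<close>

theorem theorem2p6:
  fixes scale1 :: "real \<Rightarrow> 'a::comm_monoid_add \<Rightarrow> 'a"
    and le1 :: "'a \<Rightarrow> 'a \<Rightarrow> bool"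
    and V1 P1 :: "'a set"
    and scale2 :: "real \<Rightarrow> 'b::comm_monoid_add \<Rightarrow> 'b"
    and le2 :: "'b \<Rightarrow> 'b \<Rightarrow> bool"
    and V2 :: "'b set"
    and v :: 'b
    and f g h :: "'a \<Rightarrow> 'b"
  assumes "locally_convex_cone scale1 le1 V1 P1"
    and "full_locally_convex_cone scale2 le2 V2"
    and "separated_cone le2 UNIV V2"
    and "sym_complete le2 UNIV V2"
    and "v \<in> V2"
    and "bounded_element scale2 le2 V2 v"
    and "\<And>x y. x \<in> P1 \<Longrightarrow> y \<in> P1 \<Longrightarrow> f (x + y) \<in> sym_nbhd le2 UNIV v (g x + h y)"
    and "bounded_element scale2 le2 V2 (f 0)"
  shows "\<exists>!A. A \<in> extensional P1 \<and> additive_on P1 A \<and>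
    (\<exists>\<delta>>0. \<forall>x\<in>P1.
        A x \<in> sym_nbhd le2 UNIV (scale2 \<delta> v) (f x) \<and>
        A x \<in> sym_nbhd le2 UNIV (scale2 (1 + \<delta>) v) (g x + h 0) \<and>
        A x \<in> sym_nbhd le2 UNIV (scale2 (1 + \<delta>) v) (h x + g 0))"
proof -
  interpret C1: locally_convex_cone scale1 le1 V1 P1 by fact
  interpret C2: full_locally_convex_cone scale2 le2 V2 by fact
  note sep = assms(3) and compl = assms(4) and v = assms(5) and bdd = assms(6)
  let ?close = "C2.close v"
  let ?near = "\<lambda>\<delta> A. \<forall>x\<in>P1.
        A x \<in> sym_nbhd le2 UNIV (scale2 \<delta> v) (f x) \<and>
        A x \<in> sym_nbhd le2 UNIV (scale2 (1 + \<delta>) v) (g x + h 0) \<and>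
        A x \<in> sym_nbhd le2 UNIV (scale2 (1 + \<delta>) v) (h x + g 0)"
  \<comment> \<open>Reading \<open>v\<close> as \<open>1 \<odot> v\<close> turns the hypothesis into
    closeness of radius 1.\<close>
  have fgh: "?close 1 (f (x + y)) (g x + h y)" if "x \<in> P1" "y \<in> P1" for x y
    using assms(7)[OF that] by (simp add: C2.scale_one flip: C2.sym_nbhd_iff_close)
  obtain M where M: "0 \<le> M" "\<And>x y. x \<in> P1 \<Longrightarrow> y \<in> P1 \<Longrightarrow> ?close M (f (x + y)) (f x + f y)"
    using C2.pexider_near_additive[where f = f and g = g and h = h,
        OF v C1.subcone_zero C1.subcone_add fgh assms(8)] by blast
  obtain A0 where A0: "additive_on P1 A0" "\<And>x. x \<in> P1 \<Longrightarrow> ?close (M + 1) (A0 x) (f x)"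
    using C2.hyers_additive[where f = f, OF sep compl v bdd M(1) C1.subcone_add M(2)] by blast
  \<comment> \<open>Restriction fixes the value \<open>undefined\<close> outside \<open>P1\<close>,
    so that uniqueness can be equality of HOL functions.\<close>
  define A where "A = restrict A0 P1"
  have A: "additive_on P1 A" "\<And>x. x \<in> P1 \<Longrightarrow> ?close (M + 1) (A x) (f x)"
    using A0 C1.subcone_add unfolding A_def additive_on_def by auto
  have "?near (M + 1) A"
  proof (intro ballI)
    fix x assume x: "x \<in> P1"
    \<comment> \<open>With \<open>\<delta> = M + 1\<close>, going on from
      \<open>f x = f (x + 0) = f (0 + x)\<close> costs one more unit, which gives the radius
      \<open>1 + \<delta>\<close>.\<close>
    have "?close ((M + 1) + 1) (A x) (g x + h 0)" "?close ((M + 1) + 1) (A x) (h x + g 0)"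
      using C2.close_trans[OF A(2)[OF x], of 1] fgh[OF x C1.subcone_zero]
        fgh[OF C1.subcone_zero x] M(1)
      by (simp_all add: add.commute)
    then show "A x \<in> sym_nbhd le2 UNIV (scale2 (M + 1) v) (f x) \<and>
        A x \<in> sym_nbhd le2 UNIV (scale2 (1 + (M + 1)) v) (g x + h 0) \<and>
        A x \<in> sym_nbhd le2 UNIV (scale2 (1 + (M + 1)) v) (h x + g 0)"
      using A(2)[OF x] by (simp add: C2.sym_nbhd_iff_close add.commute)
  qed
  moreover have "M + 1 > 0" using M(1) by simp
  ultimately have ex: "\<exists>\<delta>>0. ?near \<delta> A" by blast
  have uniq: "B = A" if B: "B \<in> extensional P1" "additive_on P1 B" and "\<exists>\<delta>>0. ?near \<delta> B" for B
  proof -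
    from that obtain \<delta> where d: "\<delta> > 0" "\<And>x. x \<in> P1 \<Longrightarrow> ?close \<delta> (B x) (f x)"
      unfolding C2.sym_nbhd_iff_close by blast
    \<comment> \<open>The competitor \<open>B\<close> comes with its own \<open>\<delta>\<close>;
      any radius uniform in \<open>x\<close> suffices, since doubling shrinks it.\<close>
    have "?close (\<delta> + (M + 1)) (B x) (A x)" if "x \<in> P1" for x
      using C2.close_trans[OF d(2)[OF that]] A(2)[OF that] d(1) M(1)
      by (simp add: C2.close_commute)
    from C2.additive_close_unique[OF sep bdd _ C1.subcone_add B(2) A(1) this]
    have "B x = A x" if "x \<in> P1" for x
      using d(1) M(1) that by simp
    then show ?thesis
      using B(1) by (intro extensionalityI[of _ P1]) (auto simp: A_def)
  qed
  show ?thesis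
    using A(1) ex uniq by (intro ex1I[of _ A]) (auto simp: A_def)
qed

end
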